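(* Let $\mathbf{u}$ be an infinite word over a finite alphabet $\mathcal{A}$ with $\#\mathcal{A}=k$, whose language $\mathcal{L}(\mathbf{u})$ is closed under reversal and whose factor complexity satisfies $\mathcal{C}(n)=(k-1)n+1$ for all $n\in\mathbb{N}$. Then the palindromic complexity satisfies $\mathcal{P}(n)+\mathcal{P}(n+1)=k+1$ for all $n\in\mathbb{N}$ if and only if every bispecial factor $w$ of $\mathbf{u}$ satisfies: (1) if $w$ is not a palindrome, then $\mathrm{b}(w)=0$; (2) if $w$ is a palindrome, then $\mathrm{b}(w)=\#\mathrm{Pext}(w)-1$.
   Context: An infinite word over a finite alphabet $\mathcal{A}$ is a one-sided infinite sequence $\mathbf{u}=u_0u_1u_2\ldots$ of letters of $\mathcal{A}$ in which every letter of $\mathcal{A}$ occurs. Its language $\mathcal{L}(\mathbf{u})$ is the set of all its finite factors (contiguous subwords), including the empty word; $\mathcal{C}(n)$ is the number of distinct factors of length $n$; $\mathbb{N}$ includes $0$. The reversal of $w=w_0\cdots w_{n-1}$ is $\overline{w}=w_{n-1}\cdots w_0$; $w$ is a palindrome if $w=\overline{w}$ (the empty word is a palindrome). $\mathcal{L}(\mathbf{u})$ is closed under reversal if $w\in\mathcal{L}(\mathbf{u})$ implies $\overline{w}\in\mathcal{L}(\mathbf{u})$. The palindromic complexity $\mathcal{P}(n)$ is the number of distinct palindromic factors of $\mathbf{u}$ of length $n$ (so $\mathcal{P}(0)=1$). For $w\in\mathcal{L}(\mathbf{u})$: $\mathrm{Lext}(w)=\{a\in\mathcal{A}: aw\in\mathcal{L}(\mathbf{u})\}$,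 $\mathrm{Rext}(w)=\{a\in\mathcal{A}: wa\in\mathcal{L}(\mathbf{u})\}$, $\mathrm{Bext}(w)=\{awb\in\mathcal{L}(\mathbf{u}): a,b\in\mathcal{A}\}$. A factor $w$ is bispecial if $\#\mathrm{Lext}(w)\ge 2$ and $\#\mathrm{Rext}(w)\ge 2$. The bilateral order of $w$ is $\mathrm{b}(w)=\#\mathrm{Bext}(w)-\#\mathrm{Rext}(w)-\#\mathrm{Lext}(w)+1$. For a palindrome $w$, $\mathrm{Pext}(w)=\{awa\in\mathcal{L}(\mathbf{u}): a\in\mathcal{A}\}$. *)

theory Defs
  imports "HOL-Library.Omega_Words_Fun"
begin

text \<open>
  An infinite word \<open>u\<close> is a function on \<^typ>\<open>nat\<close>. Its alphabet is \<^term>\<open>range u\<close>, since every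
  letter is required to occur. The factor at positions \<open>i, \<dots>, j - 1\<close> is \<^term>\<open>u [i \<rightarrow> j]\<close>; it is
  empty for \<^prop>\<open>i = j\<close>.
\<close>

definition language :: "'a word \<Rightarrow> 'a list set" where
  "language u = {u [i \<rightarrow> j] | i j. i \<le> j}"

definition factor_complexity :: "'a word \<Rightarrow> nat \<Rightarrow> nat" where
  "factor_complexity u n = card {w \<in> language u. length w = n}"

definition palindrome :: "'a list \<Rightarrow> bool" where
  "palindrome w \<longleftrightarrow> w = rev w"

definition palindromic_complexity :: "'a word \<Rightarrow> nat \<Rightarrow> nat" where
  "palindromic_complexity u n = card {w \<in> language u. palindrome w \<and> length w = n}"

definition closed_under_reversal :: "'a list set \<Rightarrow> bool" where
  "closed_under_reversal L \<longleftrightarrow> (\<forall>w \<in> L. rev w \<in> L)"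

definition Lext :: "'a word \<Rightarrow> 'a list \<Rightarrow> 'a set" where
  "Lext u w = {a \<in> range u. a # w \<in> language u}"

definition Rext :: "'a word \<Rightarrow> 'a list \<Rightarrow> 'a set" where
  "Rext u w = {a \<in> range u. w @ [a] \<in> language u}"

definition Bext :: "'a word \<Rightarrow> 'a list \<Rightarrow> 'a list set" where
  "Bext u w = {a # w @ [b] | a b. a \<in> range u \<and> b \<in> range u \<and> a # w @ [b] \<in> language u}"

definition Pext :: "'a word \<Rightarrow> 'a list \<Rightarrow> 'a list set" where
  "Pext u w = {a # w @ [a] | a. a \<in> range u \<and> a # w @ [a] \<in> language u}"

definition bispecial :: "'a word \<Rightarrow> 'a list \<Rightarrow> bool" where
  "bispecial u w \<longleftrightarrow> w \<in> language u \<and> card (Lext u w) \<ge> 2 \<and> card (Rext u w) \<ge> 2"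

definition bilateral_order :: "'a word \<Rightarrow> 'a list \<Rightarrow> int" where
  "bilateral_order u w =
     int (card (Bext u w)) - int (card (Rext u w)) - int (card (Lext u w)) + 1"

end

theory Submission
  imports Defs
begin

text \<open>
  Identify every factor with its reversal in the Rauzy graph of order \<open>n\<close> and drop the loops, which
  come from the palindromes of length \<open>n + 1\<close>. There remain \<open>(C(n) + P(n)) / 2\<close> vertices and
  \<open>(C(n + 1) - P(n + 1)) / 2\<close> edges, and the word is a walk through this graph; so
  \<open>P(n) + P(n + 1) \<le> C(n + 1) - C(n) + 2\<close>, with equality only if the graph is a tree. In the case of
  equality the extension graph of every factor \<open>w\<close> of length \<open>n\<close> is connected (up to reversal, when
  \<open>w\<close> is a palindrome): a cut of it would allow us to split the vertex \<open>w\<close> in two so that the word is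
  still a walk, on one vertex more and with the same number of edges. Counting the edges of a
  connected extension graph gives \<open>b(w) \<ge> 0\<close>, or \<open>b(w) \<ge> #Pext(w) - 1\<close> for a palindrome.

  The sum of \<open>b(w)\<close> over the factors of length \<open>n\<close> is the second difference of \<open>C\<close>, hence zero, and
  the sum of \<open>#Pext(w) - 1\<close> over the palindromes is \<open>P(n + 2) - P(n)\<close>. If \<open>P(n) + P(n + 1)\<close> is constant,
  both sums vanish and all the inequalities are equalities. Conversely, the equalities hold for
  factors that are not bispecial in any case, so they give \<open>P(n + 2) = P(n)\<close>, with \<open>P(0) = 1\<close> and
  \<open>P(1) = k\<close>.
\<close>

subsection \<open>Counting edges of connected graphs\<close>

text \<open>Whenever a walk reaches a new vertex it crosses a new edge, since every earlier edge
  lies inside the set of vertices already visited. Edges are unordered, so crossing one backwards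
  adds nothing to the count.\<close>

lemma card_range_le_card_steps:
  fixes y :: "nat \<Rightarrow> 'v"
  assumes fin: "finite (range y)"
  shows "card (range y) \<le> card {{y i, y (Suc i)} | i. y i \<noteq> y (Suc i)} + 1"
proof -
  define D where "D n = {{y i, y (Suc i)} | i. i < n \<and> y i \<noteq> y (Suc i)}" for n
  have D_sub: "D n \<subseteq> Pow (y ` {..n})" for n
    by (force simp: D_def)
  then have finD: "finite (D n)" for n
    by (rule finite_subset) simp
  have step: "card (y ` {..n}) \<le> card (D n) + 1" for n
  proof (induction n)
    case 0
    then show ?case by simp
  next
    case (Suc n)
    have sub: "D n \<subseteq> D (Suc n)"
      by (force simp: D_def)
    show ?case
    proof (cases "y (Suc n) \<in> y ` {..n}")
      case True
      then have "y ` {..Suc n} = y ` {..n}"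
        by (auto simp: atMost_Suc)
      then show ?thesis
        using Suc card_mono[OF finD sub] by simp
    next
      case False
      then have "y n \<noteq> y (Suc n)"
        by (metis atMost_iff imageI order_refl)
      then have "{y n, y (Suc n)} \<in> D (Suc n)"
        unfolding D_def by blast
      moreover have "{y n, y (Suc n)} \<notin> D n"
        using False D_sub[of n] by auto
      ultimately have "card (D n) < card (D (Suc n))"
        using sub finD by (metis psubset_card_mono psubsetI)
      moreover have "card (y ` {..Suc n}) \<le> card (y ` {..n}) + 1"
        by (simp add: atMost_Suc card_insert_if)
      ultimately show ?thesis
        using Suc by linarith
    qed
  qed
  \<comment> \<open>All of the finitely many values have been taken by some time \<open>N\<close>,
    so the bound for the walk up to \<open>N\<close> is enough.\<close>
  obtain M where M: "finite M" "range y = y ` M"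
    using fin finite_subset_image[of "range y" y UNIV] by auto
  obtain N where "M \<subseteq> {..N}"
    using M(1) finite_nat_iff_bounded_le by blast
  then have range: "range y = y ` {..N}"
    using M(2) by blast
  have "{{y i, y (Suc i)} | i. y i \<noteq> y (Suc i)} \<subseteq> Pow (range y)"
    by auto
  then have "finite {{y i, y (Suc i)} | i. y i \<noteq> y (Suc i)}"
    by (rule finite_subset) (simp add: fin)
  then have "card (D N) \<le> card {{y i, y (Suc i)} | i. y i \<noteq> y (Suc i)}"
    by (rule card_mono) (auto simp: D_def)
  with step[of N] range show ?thesis by simp
qed

text \<open>Connectedness is expressed by cuts, the form in which it is later refuted. A set of
  vertices grows from a single one along crossing edges; each edge so used is new among those inside
  the set, so \<open>Suc m\<close> vertices span at least \<open>m\<close> edges.\<close>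

lemma card_vertices_le_card_edges:
  fixes S :: "'v set" and E :: "'v set set"
  assumes "finite S" "finite E"
    and cut: "\<And>B. B \<subset> S \<Longrightarrow> B \<noteq> {} \<Longrightarrow> \<exists>a\<in>B. \<exists>b\<in>S - B. {a, b} \<in> E"
  shows "card S \<le> card E + 1"
proof (cases "S = {}")
  case False
  define F where "F B = {e \<in> E. e \<subseteq> B}" for B
  have finF: "finite (F B)" for B
    using assms(2) by (simp add: F_def)
  have "m < card S \<Longrightarrow> \<exists>B\<subseteq>S. card B = Suc m \<and> m \<le> card (F B)" for m
  proof (induction m)
    case 0
    obtain s where "s \<in> S" using False by blast
    then show ?case by (intro exI[of _ "{s}"]) simp
  next
    case (Suc m)
    then obtain B where B: "B \<subseteq> S" "card B = Suc m" "m \<le> card (F B)"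
      by auto
    with Suc.prems have "B \<subset> S" "B \<noteq> {}" by auto
    then obtain a b where ab: "a \<in> B" "b \<in> S" "b \<notin> B" "{a, b} \<in> E"
      using cut by blast
    have "finite B" using B(1) assms(1) finite_subset by blast
    have "{a, b} \<in> F (insert b B)" "{a, b} \<notin> F B"
      using ab by (simp_all add: F_def)
    moreover have "F B \<subseteq> F (insert b B)"
      by (auto simp: F_def)
    ultimately have "F B \<subset> F (insert b B)"
      by blast
    then have "card (F B) < card (F (insert b B))"
      by (rule psubset_card_mono[OF finF])
    then show ?case
      using B ab(2,3) \<open>finite B\<close> by (intro exI[of _ "insert b B"]) simp
  qed
  moreover have "card S - 1 < card S"
    using False assms(1) by (simp add: card_gt_0_iff)
  ultimately obtain B where "card S - 1 \<le> card (F B)"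
    by blast
  also have "\<dots> \<le> card E"
    using assms(2) by (intro card_mono) (auto simp: F_def)
  finally show ?thesis by simp
qed simp

subsection \<open>Words up to reversal\<close>

definition rev_class :: "'a list \<Rightarrow> 'a list set" where
  "rev_class w = {w, rev w}"

lemma rev_class_rev [simp]: "rev_class (rev w) = rev_class w"
  by (auto simp: rev_class_def)

lemma rev_class_eq_iff: "rev_class v = rev_class w \<longleftrightarrow> v = w \<or> v = rev w"
  unfolding rev_class_def doubleton_eq_iff by (metis rev_rev_ident)

lemma palindrome_rev [simp]: "palindrome (rev w) \<longleftrightarrow> palindrome w"
  by (metis palindrome_def rev_rev_ident)

lemma palindrome_Cons_snoc: "palindrome (a # w @ [b]) \<longleftrightarrow> a = b \<and> palindrome w"
  by (auto simp: palindrome_def)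

lemma card_rev_class_nonpalindromes:
  assumes "finite F" "\<And>w. w \<in> F \<Longrightarrow> rev w \<in> F" "\<And>w. w \<in> F \<Longrightarrow> \<not> palindrome w"
  shows "2 * card (rev_class ` F) = card F"
proof -
  have Un: "\<Union> (rev_class ` F) = F"
    using assms(2) by (auto simp: rev_class_def)
  have "2 * card (rev_class ` F) = card (\<Union> (rev_class ` F))"
  proof (rule card_partition)
    show "finite (\<Union> (rev_class ` F))"
      using assms(1) Un by simp
    show "card c = 2" if "c \<in> rev_class ` F" for c
      using that assms(3) by (auto simp: rev_class_def palindrome_def)
    show "c1 \<inter> c2 = {}" if "c1 \<in> rev_class ` F" "c2 \<in> rev_class ` F" "c1 \<noteq> c2" for c1 c2
      using that by (auto simp: rev_class_def)
  qed (use assms(1) in simp)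
  with Un show ?thesis by simp
qed

text \<open>A palindrome is alone in its class and the other words pair up with their reversals, so
  doubling the number of classes counts each palindrome once too often. This gives the number of
  vertices of the folded Rauzy graph.\<close>

lemma card_rev_class:
  assumes "finite F" "\<And>w. w \<in> F \<Longrightarrow> rev w \<in> F"
  shows "2 * card (rev_class ` F) = card F + card {w \<in> F. palindrome w}"
proof -
  define P N where "P = {w \<in> F. palindrome w}" and "N = {w \<in> F. \<not> palindrome w}"
  have F: "F = P \<union> N" "P \<inter> N = {}" "finite P" "finite N"
    using assms(1) by (auto simp: P_def N_def)
  have "rev_class ` P \<inter> rev_class ` N = {}"
    by (auto simp: P_def N_def rev_class_eq_iff)
  moreover have "inj_on rev_class P"
    by (auto simp: P_def inj_on_def rev_class_eq_iff palindrome_def)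
  ultimately have "card (rev_class ` F) = card P + card (rev_class ` N)"
    using F by (simp add: image_Un card_Un_disjoint card_image)
  moreover have "2 * card (rev_class ` N) = card N"
    using assms by (intro card_rev_class_nonpalindromes) (auto simp: N_def)
  moreover have "card F = card P + card N"
    using F by (simp add: card_Un_disjoint)
  ultimately show ?thesis by (simp add: P_def)
qed

text \<open>Being invariant under reversal, \<open>g\<close> takes one value per class, and
  nonpalindromes form classes of size two. With \<open>g\<close> sending a word to its edge, this
  bounds the number of edges that come from nonpalindromic words, both in the Rauzy graph and in the
  extension graph of a palindrome.\<close>

lemma card_image_nonpalindromes_le:
  assumes "finite F" "\<And>w. w \<in> F \<Longrightarrow> rev w \<in> F"
    and g: "\<And>w. w \<in> F \<Longrightarrow> g (rev w) = g w"
  shows "2 * card (g ` {w \<in> F. \<not> palindrome w}) + card {w \<in> F. palindrome w} \<le> card F"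
proof -
  let ?N = "{w \<in> F. \<not> palindrome w}"
  \<comment> \<open>The image of a class under \<open>g\<close> is a singleton, and
    \<open>the_elem\<close> reads off its value, so \<open>g\<close> factors through
    \<open>rev_class\<close>.\<close>
  have "g ` ?N = (\<lambda>c. the_elem (g ` c)) ` rev_class ` ?N"
    using g by (simp add: image_image rev_class_def)
  moreover have "card ((\<lambda>c. the_elem (g ` c)) ` rev_class ` ?N) \<le> card (rev_class ` ?N)"
    using assms(1) by (intro card_image_le) simp
  ultimately have "card (g ` ?N) \<le> card (rev_class ` ?N)"
    by simp
  moreover have "2 * card (rev_class ` ?N) = card ?N"
    using assms by (intro card_rev_class_nonpalindromes) auto
  moreover have "card F = card ?N + card {w \<in> F. palindrome w}"
    using assms(1) by (subst card_Un_disjoint[symmetric]) (auto intro: arg_cong[of _ _ card])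
  ultimately show ?thesis by simp
qed

subsection \<open>Factors\<close>

definition factors :: "'a word \<Rightarrow> nat \<Rightarrow> 'a list set" where
  "factors u n = {w \<in> language u. length w = n}"

definition palindromes :: "'a word \<Rightarrow> nat \<Rightarrow> 'a list set" where
  "palindromes u n = {w \<in> factors u n. palindrome w}"

lemma card_factors: "card (factors u n) = factor_complexity u n"
  by (simp add: factors_def factor_complexity_def)

lemma card_palindromes: "card (palindromes u n) = palindromic_complexity u n"
  by (auto simp: palindromes_def factors_def palindromic_complexity_def intro: arg_cong[of _ _ card])

lemma language_iff_occurs: "w \<in> language u \<longleftrightarrow> (\<exists>i. w = map u [i..<i + length w])"
proof
  assume "w \<in> language u"
  then obtain i j where "i \<le> j" "w = map u [i..<j]"
    by (auto simp: language_def subsequence_def)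
  then show "\<exists>i. w = map u [i..<i + length w]"
    by (intro exI[of _ i]) simp
next
  assume "\<exists>i. w = map u [i..<i + length w]"
  then show "w \<in> language u"
    unfolding language_def subsequence_def by (metis (mono_tags, lifting) le_add1 mem_Collect_eq)
qed

lemma map_upt_in_language: "map u [i..<j] \<in> language u"
  by (cases "i \<le> j") (auto simp: language_iff_occurs intro: exI[of _ i])

lemma factors_eq: "factors u n = range (\<lambda>i. map u [i..<i + n])"
  by (auto simp: factors_def map_upt_in_language) (auto simp: language_iff_occurs)

lemma Nil_in_language [simp]: "[] \<in> language u"
  using map_upt_in_language[of u 0 0] by simp

lemma append_in_language:
  assumes "v @ w \<in> language u"
  shows "v \<in> language u" "w \<in> language u"
proof -
  obtain i where i: "v @ w = map u [i..<i + length v + length w]"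
    using assms by (auto simp: language_iff_occurs add.assoc)
  have "v = map u [i..<i + length v]"
    using arg_cong[OF i, of "take (length v)"] by (simp add: take_map)
  moreover have "w = map u [i + length v..<i + length v + length w]"
    using arg_cong[OF i, of "drop (length v)"] by (simp add: drop_map)
  ultimately show "v \<in> language u" "w \<in> language u"
    by (metis map_upt_in_language)+
qed

lemma Cons_in_language: "a # w \<in> language u \<Longrightarrow> w \<in> language u"
  using append_in_language(2)[of "[a]" w u] by simp

lemma set_subset_range: "w \<in> language u \<Longrightarrow> set w \<subseteq> range u"
  by (auto simp: language_def subsequence_def)

lemma Lext_iff [simp]: "a \<in> Lext u w \<longleftrightarrow> a # w \<in> language u"
  using set_subset_range by (force simp: Lext_def)

lemma Rext_iff [simp]: "a \<in> Rext u w \<longleftrightarrow> w @ [a] \<in> language u"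
  using set_subset_range by (force simp: Rext_def)

lemma Bext_eq: "Bext u w = (\<lambda>(a, b). a # w @ [b]) ` {(a, b). a # w @ [b] \<in> language u}"
  using set_subset_range by (force simp: Bext_def)

lemma Pext_eq: "Pext u w = (\<lambda>a. a # w @ [a]) ` {a. a # w @ [a] \<in> language u}"
  using set_subset_range by (force simp: Pext_def)

lemma Rext_nonempty:
  assumes "w \<in> language u"
  shows "Rext u w \<noteq> {}"
proof -
  obtain i where "w = map u [i..<i + length w]"
    using assms by (auto simp: language_iff_occurs)
  then have "w @ [u (i + length w)] = map u [i..<Suc (i + length w)]"
    by (metis le_add1 list.simps(8,9) map_append upt_Suc_append)
  then show ?thesis
    by (metis Rext_iff empty_iff map_upt_in_language)
qed

section \<open>Languages closed under reversal\<close>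

locale reversal_closed_word =
  fixes u :: "'a word"
  assumes finite_range: "finite (range u)"
    and closed: "closed_under_reversal (language u)"
begin

lemma rev_in_language [simp]: "rev w \<in> language u \<longleftrightarrow> w \<in> language u"
  using closed by (metis closed_under_reversal_def rev_rev_ident)

lemma rev_snoc_in_language [simp]: "rev w @ [a] \<in> language u \<longleftrightarrow> a # w \<in> language u"
  using rev_in_language[of "a # w"] by simp

lemma Cons_rev_snoc_in_language [simp]:
  "a # rev w @ [b] \<in> language u \<longleftrightarrow> b # w @ [a] \<in> language u"
  using rev_in_language[of "b # w @ [a]"] by simp

lemma rev_in_factors: "w \<in> factors u n \<Longrightarrow> rev w \<in> factors u n"
  by (simp add: factors_def)

lemma finite_factors: "finite (factors u n)"
proof (rule finite_subset)
  show "factors u n \<subseteq> {w. set w \<subseteq> range u \<and> length w = n}"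
    using set_subset_range by (auto simp: factors_def)
qed (rule finite_lists_length_eq[OF finite_range])

lemma finite_ext [simp]:
  "finite (Lext u w)" "finite (Rext u w)" "finite (Bext u w)" "finite (Pext u w)"
proof -
  show "finite (Lext u w)" "finite (Rext u w)"
    using finite_range by (simp_all add: Lext_def Rext_def)
  show "finite (Bext u w)"
    by (rule finite_subset[OF _ finite_factors[of "length w + 2"]]) (auto simp: Bext_def factors_def)
  show "finite (Pext u w)"
    by (rule finite_subset[OF _ finite_factors[of "length w + 2"]]) (auto simp: Pext_def factors_def)
qed

text \<open>An occurrence at position 0 has no letter before it; the left extension is obtained as a
  right extension of the reversed word.\<close>

lemma Lext_nonempty:
  assumes "w \<in> language u"
  shows "Lext u w \<noteq> {}"
proof -
  obtain a where "a \<in> Rext u (rev w)"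
    using Rext_nonempty[of "rev w" u] assms by (simp only: rev_in_language) blast
  then have "a \<in> Lext u w" by simp
  then show ?thesis by blast
qed

lemma palindrome_Lext_eq_Rext:
  assumes "palindrome w"
  shows "Lext u w = Rext u w"
proof -
  have "rev w = w"
    using assms by (simp add: palindrome_def)
  then have "a \<in> Lext u w \<longleftrightarrow> a \<in> Rext u w" for a
    using rev_snoc_in_language[of w a] by simp
  then show ?thesis by blast
qed

subsection \<open>Splitting a vertex of the Rauzy graph\<close>

text \<open>
  The half-edge of the edge \<open>e\<close> at its initial factor \<open>butlast e\<close>, with the reversal class of \<open>w\<close>
  split in two according to \<open>P\<close>; the half-edge at the terminal factor is that of \<open>rev e\<close>.
\<close>

definition split_end :: "'a list \<Rightarrow> ('a list \<Rightarrow> 'a \<Rightarrow> bool) \<Rightarrow> 'a list \<Rightarrow> 'a list set \<times> bool" where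
  "split_end w P e =
     (rev_class (butlast e), rev_class (butlast e) = rev_class w \<and> P (butlast e) (last e))"

text \<open>\<open>P\<close> labels the half-edges at the class of \<open>w\<close>, and its
  assumption says that the two half-edges used in one passage \<open>a x b\<close> have equal
  labels; the entering one, read backwards, is \<open>rev x\<close> followed by \<open>a\<close>. If
  both labels occurred, the split graph would carry the same walk on one vertex more without more
  edges. Assumption \<open>pc\<close> says that the unsplit graph has at least one vertex more than
  the classes of nonpalindromic edges, which leaves no room for another.\<close>

lemma no_split:
  fixes P :: "'a list \<Rightarrow> 'a \<Rightarrow> bool"
  assumes pc: "palindromic_complexity u n + palindromic_complexity u (n + 1) + factor_complexity u n
      \<ge> factor_complexity u (n + 1) + 2"
    and w: "w \<in> factors u n"
    and P: "\<And>x a b. x \<in> rev_class w \<Longrightarrow> a # x @ [b] \<in> language u \<Longrightarrow> P (rev x) a = P x b"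
    and x: "x \<in> rev_class w" "x @ [a] \<in> language u"
    and y: "y \<in> rev_class w" "y @ [b] \<in> language u"
  shows "P x a = P y b"
proof (rule ccontr)
  assume neq: "P x a \<noteq> P y b"
  define e where "e i = map u [i..<i + Suc n]" for i
  define v where "v = split_end w P"
  have e_tl: "e i = u i # map u [Suc i..<Suc i + n]" for i
    unfolding e_def by (subst upt_conv_Cons) auto
  have e_snoc: "e i = map u [i..<i + n] @ [u (i + n)]" for i
    by (simp add: e_def)
  have range_e: "factors u (Suc n) = range e"
    by (simp add: factors_eq e_def)
  \<comment> \<open>The end at which the walk leaves edge \<open>e i\<close> is the end at which it
    enters \<open>e (Suc i)\<close>. Only here is the compatibility of \<open>P\<close> with
    passages used.\<close>
  have glue: "v (rev (e i)) = v (e (Suc i))" for i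
  proof -
    define z where "z = map u [Suc i..<Suc i + n]"
    have "u i # z @ [u (Suc i + n)] = map u [i..<Suc (Suc i + n)]"
      unfolding z_def by (subst upt_conv_Cons) auto
    then have "u i # z @ [u (Suc i + n)] \<in> language u"
      by (metis map_upt_in_language)
    then have "rev_class z = rev_class w \<Longrightarrow> P (rev z) (u i) = P z (u (Suc i + n))"
      using P[of z] by (auto simp: rev_class_def)
    moreover have "e i = u i # z" "e (Suc i) = z @ [u (Suc i + n)]"
      using e_tl[of i] e_snoc[of "Suc i"] by (simp_all add: z_def)
    ultimately show ?thesis
      by (auto simp: v_def split_end_def)
  qed
  let ?Y = "range (\<lambda>i. v (e i))"
  have Y_eq: "?Y = v ` factors u (Suc n)"
    by (auto simp: range_e)
  then have finY: "finite ?Y"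
    using finite_factors by simp
  define g where "g = (\<lambda>f. {v f, v (rev f)})"
  let ?N = "{f \<in> factors u (Suc n). \<not> palindrome f}"
  \<comment> \<open>By \<open>glue\<close>, step \<open>i\<close> of the walk runs along the edge
    \<open>g (e i)\<close>; a palindromic \<open>e i\<close> gives a loop and hence no step.\<close>
  have "{{v (e i), v (e (Suc i))} | i. v (e i) \<noteq> v (e (Suc i))} \<subseteq> g ` ?N"
  proof clarify
    fix i assume "v (e i) \<noteq> v (e (Suc i))"
    then have "\<not> palindrome (e i)"
      by (metis glue palindrome_def)
    then show "{v (e i), v (e (Suc i))} \<in> g ` ?N"
      using glue by (intro image_eqI[of _ _ "e i"]) (auto simp: g_def range_e)
  qed
  then have "card {{v (e i), v (e (Suc i))} | i. v (e i) \<noteq> v (e (Suc i))} \<le> card (g ` ?N)"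
    using finite_factors by (intro card_mono) auto
  then have "card ?Y \<le> card (g ` ?N) + 1"
    using card_range_le_card_steps[OF finY] by simp
  moreover have "2 * card (g ` ?N) + palindromic_complexity u (Suc n) \<le> factor_complexity u (Suc n)"
    unfolding card_factors[symmetric] card_palindromes[symmetric] palindromes_def
    using finite_factors rev_in_factors by (intro card_image_nonpalindromes_le) (auto simp: g_def)
  \<comment> \<open>Classes other than that of \<open>w\<close> have label \<open>False\<close> by
    definition of \<open>split_end\<close>; the class of \<open>w\<close> appears with both labels,
    as \<open>P x a\<close> and \<open>P y b\<close> differ.\<close>
  moreover have "card (rev_class ` factors u n) + 1 \<le> card ?Y"
  proof -
    let ?V = "(\<lambda>c. (c, False)) ` rev_class ` factors u n"
    have v_snoc: "v (z @ [c]) = (rev_class z, rev_class z = rev_class w \<and> P z c)" for z c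
      by (simp add: v_def split_end_def)
    have mem: "v (z @ [c]) \<in> ?Y" if "z @ [c] \<in> language u" "length z = n" for z c
      using that unfolding Y_eq by (auto simp: factors_def)
    have label: "(rev_class w, P z c) \<in> ?Y" if "z \<in> rev_class w" "z @ [c] \<in> language u" for z c
    proof -
      have "length z = n" "rev_class z = rev_class w"
        using that(1) w by (auto simp: rev_class_def factors_def)
      with mem[OF that(2)] show ?thesis
        by (simp only: v_snoc simp_thms)
    qed
    have both: "(rev_class w, True) \<in> ?Y" "(rev_class w, False) \<in> ?Y"
      using label[OF x] label[OF y] neq by (cases "P x a"; simp)+
    have "?V \<subseteq> ?Y"
    proof clarify
      fix z assume z: "z \<in> factors u n"
      show "(rev_class z, False) \<in> ?Y"
      proof (cases "rev_class z = rev_class w")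
        case True
        with both show ?thesis by simp
      next
        case False
        obtain c where "z @ [c] \<in> language u"
          using Rext_nonempty[of z u] z by (auto simp: factors_def)
        with mem[of z c] z False show ?thesis
          by (simp add: v_snoc factors_def)
      qed
    qed
    then have "card (insert (rev_class w, True) ?V) \<le> card ?Y"
      using both by (intro card_mono[OF finY]) auto
    moreover have "card ?V = card (rev_class ` factors u n)"
      by (intro card_image) (auto simp: inj_on_def)
    moreover have "card (insert (rev_class w, True) ?V) = card ?V + 1"
      using finite_factors by (subst card_insert_disjoint) auto
    ultimately show ?thesis by simp
  qed
  moreover have "2 * card (rev_class ` factors u n) = factor_complexity u n + palindromic_complexity u n"
    unfolding card_factors[symmetric] card_palindromes[symmetric] palindromes_def
    using finite_factors rev_in_factors by (intro card_rev_class)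
  ultimately show False
    using pc by simp
qed

section \<open>Lower bounds for bilateral orders\<close>

text \<open>The extension graph is bipartite, with \<open>Inl\<close> for left and
  \<open>Inr\<close> for right letters and an edge for each \<open>a w b\<close>. A cut of it would
  be a labelling excluded by \<open>no_split\<close>, so it is connected and has at least #Lext +
  #Rext - 1 edges.\<close>

lemma bilateral_order_nonneg:
  assumes pc: "palindromic_complexity u n + palindromic_complexity u (n + 1) + factor_complexity u n
      \<ge> factor_complexity u (n + 1) + 2"
    and w: "w \<in> factors u n" "\<not> palindrome w"
  shows "bilateral_order u w \<ge> 0"
proof -
  define S where "S = Inl ` Lext u w \<union> Inr ` Rext u w"
  define E where "E = (\<lambda>(a, b). {Inl a, Inr b}) ` {(a, b). a # w @ [b] \<in> language u}"
  have nrev: "w \<noteq> rev w" "rev w \<noteq> w"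
    using w(2) by (auto simp: palindrome_def)
  have card_E: "card E = card (Bext u w)"
    unfolding E_def Bext_eq by (subst (1 2) card_image) (auto simp: inj_on_def doubleton_eq_iff)
  have "card S \<le> card E + 1"
  proof (rule card_vertices_le_card_edges)
    show "finite S" by (simp add: S_def)
    have "E = (\<lambda>e. {Inl (hd e), Inr (last e)}) ` Bext u w"
      by (auto simp: E_def Bext_eq image_image intro!: image_cong)
    then show "finite E" by simp
    fix B assume B: "B \<subset> S" "B \<noteq> {}"
    show "\<exists>a\<in>B. \<exists>b\<in>S - B. {a, b} \<in> E"
    proof (rule ccontr)
      assume none: "\<not> (\<exists>a\<in>B. \<exists>b\<in>S - B. {a, b} \<in> E)"
      have sep: "Inl a \<in> B \<longleftrightarrow> Inr b \<in> B" if "a # w @ [b] \<in> language u" for a b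
      proof -
        have "{Inl a, Inr b} \<in> E" "{Inr b, Inl a} \<in> E"
          using that by (auto simp: E_def)
        moreover have "Inl a \<in> S" "Inr b \<in> S"
          using that append_in_language(1)[of "a # w" "[b]" u] Cons_in_language[of a "w @ [b]" u]
          by (auto simp: S_def)
        ultimately show ?thesis
          using none by blast
      qed
      \<comment> \<open>A letter \<open>b\<close> after \<open>rev w\<close> is a left extension of
        \<open>w\<close>, hence \<open>Inl b\<close>. The two cases are distinct because
        \<open>w\<close> is not a palindrome.\<close>
      define P where "P x b = (if x = w then Inr b \<in> B else Inl b \<in> B)" for x b
      have P_const: "P x a = P y b"
        if "x \<in> rev_class w" "x @ [a] \<in> language u" "y \<in> rev_class w" "y @ [b] \<in> language u" for x y a b
      proof (rule no_split[OF pc w(1) _ that])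
        fix x a b assume "x \<in> rev_class w" "a # x @ [b] \<in> language u"
        then show "P (rev x) a = P x b"
          using sep[of a b] sep[of b a] nrev by (auto simp: rev_class_def P_def)
      qed
      have label: "\<exists>x a. x \<in> rev_class w \<and> x @ [a] \<in> language u \<and> (s \<in> B \<longleftrightarrow> P x a)"
        if "s \<in> S" for s
      proof (cases s)
        case (Inl a)
        with that have "rev w @ [a] \<in> language u" by (auto simp: S_def)
        moreover have "s \<in> B \<longleftrightarrow> P (rev w) a"
          using nrev(2) Inl by (simp add: P_def)
        ultimately show ?thesis
          unfolding rev_class_def by blast
      next
        case (Inr b)
        with that have "w @ [b] \<in> language u" by (auto simp: S_def)
        moreover have "s \<in> B \<longleftrightarrow> P w b"
          using Inr by (simp add: P_def)
        ultimately show ?thesis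
          unfolding rev_class_def by blast
      qed
      have "s \<in> B \<longleftrightarrow> t \<in> B" if "s \<in> S" "t \<in> S" for s t
        using label[OF that(1)] label[OF that(2)] P_const by metis
      then show False
        using B by blast
    qed
  qed
  moreover have "card S = card (Lext u w) + card (Rext u w)"
    unfolding S_def by (subst card_Un_disjoint) (auto simp: card_image)
  ultimately show ?thesis
    using card_E by (simp add: bilateral_order_def)
qed

text \<open>Here left and right letters coincide, so the extension graph is folded onto
  \<open>Rext u w\<close>: \<open>a w b\<close> and \<open>b w a\<close> give one edge, and the
  elements of \<open>Pext u w\<close> are loops, which are dropped. Connectedness gives #Rext - 1
  edges, each from at least two words of \<open>Bext u w\<close> outside
  \<open>Pext u w\<close>.\<close>

lemma bilateral_order_palindrome_ge:
  assumes pc: "palindromic_complexity u n + palindromic_complexity u (n + 1) + factor_complexity u n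
      \<ge> factor_complexity u (n + 1) + 2"
    and w: "w \<in> factors u n" "palindrome w"
  shows "bilateral_order u w \<ge> int (card (Pext u w)) - 1"
proof -
  define E where "E = (\<lambda>e. {hd e, last e}) ` {e \<in> Bext u w. \<not> palindrome e}"
  have w_rev: "rev w = w"
    using w(2) by (simp add: palindrome_def)
  have class_w: "rev_class w = {w}"
    by (simp add: rev_class_def w_rev)
  have pal_iff: "palindrome (a # w @ [b]) \<longleftrightarrow> a = b" for a b
    using w(2) by (simp add: palindrome_Cons_snoc)
  have "card (Rext u w) \<le> card E + 1"
  proof (rule card_vertices_le_card_edges)
    show "finite E" by (simp add: E_def)
    fix B assume B: "B \<subset> Rext u w" "B \<noteq> {}"
    show "\<exists>a\<in>B. \<exists>b\<in>Rext u w - B. {a, b} \<in> E"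
    proof (rule ccontr)
      assume none: "\<not> (\<exists>a\<in>B. \<exists>b\<in>Rext u w - B. {a, b} \<in> E)"
      have sep: "a \<in> B \<longleftrightarrow> b \<in> B" if "a # w @ [b] \<in> language u" for a b
      proof (cases "a = b")
        case False
        have "a # w @ [b] \<in> Bext u w"
          using that by (auto simp: Bext_eq)
        then have "{a, b} \<in> E" "{b, a} \<in> E"
          using False by (force simp: E_def pal_iff insert_commute)+
        moreover have "a \<in> Rext u w" "b \<in> Rext u w"
          using that append_in_language(1)[of "a # w" "[b]" u] Cons_in_language[of a "w @ [b]" u]
            palindrome_Lext_eq_Rext[OF w(2)] by auto
        ultimately show ?thesis
          using none by blast
      qed simp
      have "a \<in> B \<longleftrightarrow> b \<in> B" if "a \<in> Rext u w" "b \<in> Rext u w" for a b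
      proof (rule no_split[OF pc w(1), where P = "\<lambda>_ b. b \<in> B" and x = w and y = w])
        show "(c \<in> B) = (d \<in> B)" if "x \<in> rev_class w" "c # x @ [d] \<in> language u" for x c d
          using that sep[of c d] by (simp add: class_w)
      qed (use that in \<open>simp_all add: class_w\<close>)
      then show False
        using B by blast
    qed
  qed simp
  moreover have "2 * card E + card {e \<in> Bext u w. palindrome e} \<le> card (Bext u w)"
    unfolding E_def
  proof (rule card_image_nonpalindromes_le)
    fix e assume e: "e \<in> Bext u w"
    then show "rev e \<in> Bext u w"
      using Cons_rev_snoc_in_language[of _ w] by (force simp: Bext_eq w_rev)
    show "{hd (rev e), last (rev e)} = {hd e, last e}"
      using e by (auto simp: Bext_eq)
  qed simp
  moreover have "{e \<in> Bext u w. palindrome e} = Pext u w"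
    by (auto simp: Bext_eq Pext_eq pal_iff)
  ultimately show ?thesis
    using palindrome_Lext_eq_Rext[OF w(2)] by (simp add: bilateral_order_def)
qed

subsection \<open>Summing bilateral orders\<close>

text \<open>Conditions (1) and (2) prescribe this value for bispecial factors. As one function on
  words it can be summed over all factors of a length.\<close>

definition expected_order :: "'a list \<Rightarrow> int" where
  "expected_order w = (if palindrome w then int (card (Pext u w)) - 1 else 0)"

lemma sum_card_Rext: "(\<Sum>w\<in>factors u n. card (Rext u w)) = factor_complexity u (Suc n)"
proof -
  have "factors u (Suc n) = (\<lambda>(w, a). w @ [a]) ` (SIGMA w:factors u n. Rext u w)"
  proof (intro equalityI subsetI)
    fix e assume "e \<in> factors u (Suc n)"
    then show "e \<in> (\<lambda>(w, a). w @ [a]) ` (SIGMA w:factors u n. Rext u w)"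
      by (cases e rule: rev_cases) (auto simp: factors_def dest: append_in_language)
  qed (auto simp: factors_def)
  moreover have "inj_on (\<lambda>(w, a). w @ [a]) (SIGMA w:factors u n. Rext u w)"
    by (auto simp: inj_on_def)
  ultimately show ?thesis
    using finite_factors by (simp add: card_factors[symmetric] card_image)
qed

lemma sum_card_Lext: "(\<Sum>w\<in>factors u n. card (Lext u w)) = factor_complexity u (Suc n)"
proof -
  have "factors u (Suc n) = (\<lambda>(w, a). a # w) ` (SIGMA w:factors u n. Lext u w)"
  proof (intro equalityI subsetI)
    fix e assume "e \<in> factors u (Suc n)"
    then show "e \<in> (\<lambda>(w, a). a # w) ` (SIGMA w:factors u n. Lext u w)"
      by (cases e) (auto simp: factors_def dest: Cons_in_language)
  qed (auto simp: factors_def)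
  moreover have "inj_on (\<lambda>(w, a). a # w) (SIGMA w:factors u n. Lext u w)"
    by (auto simp: inj_on_def)
  ultimately show ?thesis
    using finite_factors by (simp add: card_factors[symmetric] card_image)
qed

lemma inner_factor:
  assumes "e \<in> factors u (Suc (Suc n))"
  obtains a w b where "e = a # w @ [b]" "w \<in> factors u n"
proof -
  obtain a e' where e': "e = a # e'" "length e' = Suc n"
    using assms by (cases e) (auto simp: factors_def)
  then obtain w b where "e' = w @ [b]"
    by (cases e' rule: rev_cases) auto
  with e' assms that[of a w b] show thesis
    by (auto simp: factors_def dest: Cons_in_language append_in_language)
qed

lemma sum_card_Bext: "(\<Sum>w\<in>factors u n. card (Bext u w)) = factor_complexity u (Suc (Suc n))"
proof -
  have "factors u (Suc (Suc n)) = (\<Union>w\<in>factors u n. Bext u w)"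
  proof (intro equalityI subsetI)
    fix e assume e: "e \<in> factors u (Suc (Suc n))"
    then obtain a w b where w: "e = a # w @ [b]" "w \<in> factors u n"
      by (rule inner_factor)
    with e have "e \<in> Bext u w"
      by (auto simp: Bext_eq factors_def)
    with w(2) show "e \<in> (\<Union>w\<in>factors u n. Bext u w)" by blast
  qed (auto simp: factors_def Bext_eq)
  moreover have "Bext u v \<inter> Bext u w = {}" if "v \<noteq> w" for v w
    using that by (auto simp: Bext_eq)
  then have "card (\<Union>w\<in>factors u n. Bext u w) = (\<Sum>w\<in>factors u n. card (Bext u w))"
    using finite_factors by (intro card_UN_disjoint) simp_all
  ultimately show ?thesis
    by (simp add: card_factors[symmetric])
qed

text \<open>Removing both end letters of a palindrome leaves a palindrome, so the sets
  \<open>Pext u w\<close> partition the palindromes two letters longer.\<close>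

lemma sum_card_Pext:
  "(\<Sum>w\<in>palindromes u n. card (Pext u w)) = palindromic_complexity u (Suc (Suc n))"
proof -
  have "palindromes u (Suc (Suc n)) = (\<Union>w\<in>palindromes u n. Pext u w)"
  proof (intro equalityI subsetI)
    fix e assume "e \<in> palindromes u (Suc (Suc n))"
    then have e: "e \<in> factors u (Suc (Suc n))" "palindrome e"
      by (simp_all add: palindromes_def)
    obtain a w b where w: "e = a # w @ [b]" "w \<in> factors u n"
      using e(1) by (rule inner_factor)
    then have "e \<in> Pext u w" "w \<in> palindromes u n"
      using e by (auto simp: Pext_eq palindrome_Cons_snoc palindromes_def factors_def)
    then show "e \<in> (\<Union>w\<in>palindromes u n. Pext u w)" by blast
  qed (auto simp: factors_def palindromes_def palindrome_Cons_snoc Pext_eq)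
  moreover have "Pext u v \<inter> Pext u w = {}" if "v \<noteq> w" for v w
    using that by (auto simp: Pext_eq)
  then have "card (\<Union>w\<in>palindromes u n. Pext u w) = (\<Sum>w\<in>palindromes u n. card (Pext u w))"
    using finite_factors by (intro card_UN_disjoint) (simp_all add: palindromes_def)
  ultimately show ?thesis
    by (simp add: card_palindromes[symmetric])
qed

lemma sum_bilateral_order:
  "(\<Sum>w\<in>factors u n. bilateral_order u w) =
     int (factor_complexity u (Suc (Suc n))) - 2 * int (factor_complexity u (Suc n))
       + int (factor_complexity u n)"
proof -
  have "(\<Sum>w\<in>factors u n. bilateral_order u w) =
      int (\<Sum>w\<in>factors u n. card (Bext u w)) - int (\<Sum>w\<in>factors u n. card (Rext u w))
        - int (\<Sum>w\<in>factors u n. card (Lext u w)) + int (card (factors u n))"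
    by (simp add: bilateral_order_def sum.distrib sum_subtractf)
  then show ?thesis
    by (simp only: sum_card_Bext sum_card_Rext sum_card_Lext card_factors)
qed

lemma sum_expected_order:
  "(\<Sum>w\<in>factors u n. expected_order w) =
     int (palindromic_complexity u (Suc (Suc n))) - int (palindromic_complexity u n)"
proof -
  have "(\<Sum>w\<in>factors u n. expected_order w) = (\<Sum>w\<in>palindromes u n. int (card (Pext u w)) - 1)"
    unfolding expected_order_def palindromes_def using finite_factors
    by (simp add: sum.inter_filter)
  also have "\<dots> = int (\<Sum>w\<in>palindromes u n. card (Pext u w)) - int (card (palindromes u n))"
    by (simp add: sum_subtractf)
  finally show ?thesis
    by (simp only: sum_card_Pext card_palindromes)
qed

section \<open>Factors that are not bispecial\<close>

text \<open>If one side admits a single letter, that letter fits every extension on the other side,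
  because each extended word can itself be extended. So \<open>Bext u w\<close> is in bijection with
  the other side and the order is 0.\<close>

lemma bilateral_order_not_bispecial:
  assumes w: "w \<in> language u" "\<not> bispecial u w"
  shows "bilateral_order u w = expected_order w"
proof -
  have ne: "card (Lext u w) > 0" "card (Rext u w) > 0"
    using Lext_nonempty[OF w(1)] Rext_nonempty[OF w(1)] by (simp_all add: card_gt_0_iff)
  then consider (L) "card (Lext u w) = 1" | (R) "card (Rext u w) = 1"
    using w by (force simp: bispecial_def)
  then have B: "card (Bext u w) + 1 = card (Lext u w) + card (Rext u w)"
  proof cases
    case L
    then obtain a where a: "Lext u w = {a}"
      by (rule card_1_singletonE)
    have "Bext u w = (\<lambda>b. a # w @ [b]) ` Rext u w"
    proof (intro equalityI subsetI)
      fix e assume "e \<in> Bext u w"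
      then obtain c b where e: "e = c # w @ [b]" "e \<in> language u"
        by (auto simp: Bext_eq)
      then have "c \<in> Lext u w" "b \<in> Rext u w"
        using append_in_language(1)[of "c # w" "[b]" u] Cons_in_language[of c "w @ [b]" u] by auto
      with a e show "e \<in> (\<lambda>b. a # w @ [b]) ` Rext u w" by auto
    next
      fix e assume "e \<in> (\<lambda>b. a # w @ [b]) ` Rext u w"
      then obtain b where b: "e = a # w @ [b]" "w @ [b] \<in> language u" by auto
      then obtain c where c: "c # w @ [b] \<in> language u"
        using Lext_nonempty[of "w @ [b]"] by auto
      then have "c \<in> Lext u w"
        using append_in_language(1)[of "c # w" "[b]" u] by simp
      with a b c show "e \<in> Bext u w" by (auto simp: Bext_eq)
    qed
    then have "card (Bext u w) = card (Rext u w)"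
      by (simp add: card_image inj_on_def)
    with L show ?thesis by simp
  next
    case R
    then obtain b where b: "Rext u w = {b}"
      by (rule card_1_singletonE)
    have "Bext u w = (\<lambda>a. a # w @ [b]) ` Lext u w"
    proof (intro equalityI subsetI)
      fix e assume "e \<in> Bext u w"
      then obtain a c where e: "e = a # w @ [c]" "e \<in> language u"
        by (auto simp: Bext_eq)
      then have "a \<in> Lext u w" "c \<in> Rext u w"
        using append_in_language(1)[of "a # w" "[c]" u] Cons_in_language[of a "w @ [c]" u] by auto
      with b e show "e \<in> (\<lambda>a. a # w @ [b]) ` Lext u w" by auto
    next
      fix e assume "e \<in> (\<lambda>a. a # w @ [b]) ` Lext u w"
      then obtain a where a: "e = a # w @ [b]" "a # w \<in> language u" by auto
      then obtain c where c: "a # w @ [c] \<in> language u"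
        using Rext_nonempty[of "a # w" u] by auto
      then have "c \<in> Rext u w"
        using Cons_in_language[of a "w @ [c]" u] by simp
      with a b c show "e \<in> Bext u w" by (auto simp: Bext_eq)
    qed
    then have "card (Bext u w) = card (Lext u w)"
      by (simp add: card_image inj_on_def)
    with R show ?thesis by simp
  qed
  \<comment> \<open>For a palindrome both sides admit the same single letter \<open>a\<close>, so
    \<open>a w a\<close> is the only bilateral extension.\<close>
  have "card (Pext u w) = 1" if pal: "palindrome w"
  proof -
    have "card (Rext u w) = 1"
      using w ne palindrome_Lext_eq_Rext[OF pal] by (force simp: bispecial_def)
    then obtain a where a: "Rext u w = {a}"
      by (rule card_1_singletonE)
    then obtain c where c: "c # w @ [a] \<in> language u"
      using Lext_nonempty[of "w @ [a]"] Rext_iff[of a u w] by auto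
    have first: "b = a" if "b # w @ [d] \<in> language u" for b d
    proof -
      have "b \<in> Lext u w"
        using that append_in_language(1)[of "b # w" "[d]" u] by simp
      with a palindrome_Lext_eq_Rext[OF pal] show ?thesis by blast
    qed
    have "a # w @ [a] \<in> language u"
      using c first[OF c] by simp
    then have "Pext u w = {a # w @ [a]}"
      by (auto simp: Pext_eq dest: first)
    then show ?thesis by simp
  qed
  with B show ?thesis
    by (auto simp: bilateral_order_def expected_order_def)
qed

end

section \<open>Constant palindromic sums and the orders of bispecial factors\<close>

theorem theorem26:
  fixes A :: "'a set" and u :: "'a word" and k :: nat
  assumes "finite A" and "range u = A" and "card A = k"
    and "closed_under_reversal (language u)"
    and "\<And>n. int (factor_complexity u n) = (int k - 1) * int n + 1"
  shows "(\<forall>n. palindromic_complexity u n + palindromic_complexity u (n + 1) = k + 1) \<longleftrightarrow>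
    (\<forall>w. bispecial u w \<longrightarrow>
       (\<not> palindrome w \<longrightarrow> bilateral_order u w = 0) \<and>
       (palindrome w \<longrightarrow> bilateral_order u w = int (card (Pext u w)) - 1))"
proof -
  interpret reversal_closed_word u
    using assms by unfold_locales auto
  have sum_b: "(\<Sum>w\<in>factors u n. bilateral_order u w) = 0" for n
    unfolding sum_bilateral_order assms(5) by (simp add: algebra_simps)
  have bispecial_iff: "(\<forall>w. bispecial u w \<longrightarrow>
       (\<not> palindrome w \<longrightarrow> bilateral_order u w = 0) \<and>
       (palindrome w \<longrightarrow> bilateral_order u w = int (card (Pext u w)) - 1)) \<longleftrightarrow>
    (\<forall>w\<in>language u. bilateral_order u w = expected_order w)"
    (is "?L \<longleftrightarrow> ?R")
  proof -
    have "?L \<longleftrightarrow> (\<forall>w. bispecial u w \<longrightarrow> bilateral_order u w = expected_order w)"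
      by (auto simp: expected_order_def)
    also have "\<dots> \<longleftrightarrow> ?R"
      using bilateral_order_not_bispecial by (metis bispecial_def)
    finally show ?thesis .
  qed
  show ?thesis
    unfolding bispecial_iff
  proof
    assume pc: "\<forall>n. palindromic_complexity u n + palindromic_complexity u (n + 1) = k + 1"
    show "\<forall>w\<in>language u. bilateral_order u w = expected_order w"
    proof
      fix w assume "w \<in> language u"
      define n where "n = length w"
      have w: "w \<in> factors u n"
        using \<open>w \<in> language u\<close> by (simp add: factors_def n_def)
      \<comment> \<open>The first difference of the complexity is \<open>k - 1\<close>, so a
        palindromic sum of \<open>k + 1\<close> is exactly the equality case required by the lower
        bounds.\<close>
      have "int (factor_complexity u (n + 1)) = int (factor_complexity u n) + int k - 1"
        unfolding assms(5) by (simp add: algebra_simps)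
      then have "palindromic_complexity u n + palindromic_complexity u (n + 1) + factor_complexity u n
          \<ge> factor_complexity u (n + 1) + 2"
        using pc[rule_format, of n] by linarith
      then have ge: "bilateral_order u v - expected_order v \<ge> 0" if "v \<in> factors u n" for v
        using that bilateral_order_nonneg bilateral_order_palindrome_ge
        by (simp add: expected_order_def)
      have "palindromic_complexity u (Suc (Suc n)) = palindromic_complexity u n"
        using pc[rule_format, of n] pc[rule_format, of "Suc n"] by simp
      then have "(\<Sum>v\<in>factors u n. bilateral_order u v - expected_order v) = 0"
        by (simp add: sum_subtractf sum_b sum_expected_order)
      \<comment> \<open>Nonnegative terms with sum zero all vanish.\<close>
      then have "\<forall>v\<in>factors u n. bilateral_order u v - expected_order v = 0"
        using ge finite_factors by (subst (asm) sum_nonneg_eq_0_iff) auto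
      with w show "bilateral_order u w = expected_order w" by simp
    qed
  next
    assume "\<forall>w\<in>language u. bilateral_order u w = expected_order w"
    then have "(\<Sum>w\<in>factors u n. expected_order w) = 0" for n
      using sum_b[of n] by (simp add: factors_def)
    then have period: "palindromic_complexity u (Suc (Suc n)) = palindromic_complexity u n" for n
      by (simp add: sum_expected_order)
    have "palindromes u 0 = {[]}"
      by (auto simp: palindromes_def factors_def palindrome_def)
    then have P0: "palindromic_complexity u 0 = 1"
      by (simp add: card_palindromes[symmetric])
    \<comment> \<open>One-letter words are palindromes, so the sum starts at \<open>1 + k\<close>;
      period two of the palindromic complexity then keeps it constant.\<close>
    have "palindromes u 1 = factors u 1"
      by (auto simp: palindromes_def factors_def palindrome_def length_Suc_conv)
    moreover have "factor_complexity u 1 = k"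
      using assms(5)[of 1] by simp
    ultimately have P1: "palindromic_complexity u 1 = k"
      by (metis card_factors card_palindromes)
    show "\<forall>n. palindromic_complexity u n + palindromic_complexity u (n + 1) = k + 1"
    proof
      fix n show "palindromic_complexity u n + palindromic_complexity u (n + 1) = k + 1"
        by (induction n) (use P0 P1 period in simp_all)
    qed
  qed
qed

end
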